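(* Let $(P,\lambda)$ be a marked poset with all minimal elements of $P$ marked and let $t\in[0,1]^{\tilde P}$. Define $\varphi_t,\psi_t\colon\mathbb{R}^P\to\mathbb{R}^P$ by $$\varphi_t(x)_p=\begin{cases}x_p & p\in P^*,\\ x_p-t_p\max_{q\prec p}x_q & \text{otherwise},\end{cases}\qquad \psi_t(y)_p=\begin{cases}y_p & p\in P^*,\\ y_p+t_p\max_{q\prec p}\psi_t(y)_q & \text{otherwise}\end{cases}$$ (the latter defined recursively). Then $\varphi_t$ and $\psi_t$ are mutually inverse, and $\varphi_t$ restricts to a piecewise-linear bijection from $\mathcal{O}(P,\lambda)$ onto $\mathcal{O}_t(P,\lambda)$.
   Context: A marked poset $(P,\lambda)$ consists of a finite poset $P$ together with an order-preserving map $\lambda\colon P^*\to\mathbb{R}$ on an induced subposet $P^*\subseteq P$; elements of $P^*$ are marked and $\tilde P=P\setminus P^*$. Write $p\prec q$ if $q$ covers $p$. For $t\in[0,1]^{\tilde P}$, $\mathcal{O}_t(P,\lambda)\subseteq\mathbb{R}^P$ is the set of $x$ with $x_a=\lambda(a)$ for $a\in P^*$ and, for every saturated chain $p_0\prec p_1\prec\cdots\prec p_r\prec p$ with $p_0\in P^*$, $p_1,\dots,p_r\in\tilde P$, $p\in P$, $r\ge0$: $(1-t_p)(t_{p_1}\cdots t_{p_r}x_{p_0}+t_{p_2}\cdots t_{p_r}x_{p_1}+\cdots+t_{p_r}x_{p_{r-1}}+x_{p_r})\le x_p$, with $t_p:=0$ for $p\in P^*$. The marked order polyhedron $\mathcal{O}(P,\lambda)=\mathcal{O}_{\mathbf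 0}(P,\lambda)$ is the set of $x$ with $x_a=\lambda(a)$ for $a\in P^*$ and $x_p\le x_q$ whenever $p\prec q$. *)

theory Defs
  imports "HOL-Analysis.Analysis"
begin

text \<open>
  A finite poset is a type of class \<open>finite\<close> and \<open>order\<close>, so that the space of real vectors
  indexed by it is \<open>real ^ 'p\<close>. The set of marked elements is \<open>M\<close>; the marking \<open>lam\<close> is a total
  function of which only the values on \<open>M\<close> are ever used, and the parameter \<open>t\<close> is a total
  function of which only the values off \<open>M\<close> are ever used.
\<close>

definition covered_by :: "'p::order \<Rightarrow> 'p \<Rightarrow> bool"  (infix "\<prec>c" 50) where
  "p \<prec>c q \<longleftrightarrow> p < q \<and> \<not> (\<exists>z. p < z \<and> z < q)"

definition marked_poset :: "'p::{finite,order} set \<Rightarrow> ('p \<Rightarrow> real) \<Rightarrow> bool" where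
  "marked_poset M lam \<longleftrightarrow> mono_on M lam"

definition minimal_elements_marked :: "'p::{finite,order} set \<Rightarrow> bool" where
  "minimal_elements_marked M \<longleftrightarrow> (\<forall>p. (\<nexists>q. q < p) \<longrightarrow> p \<in> M)"

definition param_ext :: "'p set \<Rightarrow> ('p \<Rightarrow> real) \<Rightarrow> 'p \<Rightarrow> real" where
  "param_ext M t p = (if p \<in> M then 0 else t p)"

text \<open>
  The list \<open>ps\<close> is \<open>[p\<^sub>0, \<dots>, p\<^sub>r]\<close>, with \<open>r = length ps - 1 \<ge> 0\<close>.
\<close>

definition marked_chain_to :: "'p::{finite,order} set \<Rightarrow> 'p list \<Rightarrow> 'p \<Rightarrow> bool" where
  "marked_chain_to M ps p \<longleftrightarrow>
     ps \<noteq> [] \<and> hd ps \<in> M \<and> set (tl ps) \<subseteq> - M \<and> successively (\<prec>c) (ps @ [p])"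

definition poset_polyhedron ::
  "'p set \<Rightarrow> ('p \<Rightarrow> real) \<Rightarrow> ('p \<Rightarrow> real) \<Rightarrow> (real ^ 'p::{finite,order}) set" where
  "poset_polyhedron M lam t =
     {x. (\<forall>a\<in>M. x $ a = lam a) \<and>
         (\<forall>ps p. marked_chain_to M ps p \<longrightarrow>
            (1 - param_ext M t p) *
              (\<Sum>i<length ps. (\<Prod>j\<in>{i<..<length ps}. t (ps ! j)) * x $ (ps ! i)) \<le> x $ p)}"

definition marked_order_polyhedron ::
  "'p set \<Rightarrow> ('p \<Rightarrow> real) \<Rightarrow> (real ^ 'p::{finite,order}) set" where
  "marked_order_polyhedron M lam =
     {x. (\<forall>a\<in>M. x $ a = lam a) \<and> (\<forall>p q. p \<prec>c q \<longrightarrow> x $ p \<le> x $ q)}"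

definition phi ::
  "'p set \<Rightarrow> ('p \<Rightarrow> real) \<Rightarrow> real ^ 'p::{finite,order} \<Rightarrow> real ^ 'p::{finite,order}" where
  "phi M t x = (\<chi> p. if p \<in> M then x $ p else x $ p - t p * Max ((\<lambda>q. x $ q) ` {q. q \<prec>c p}))"

function psi_at ::
  "'p set \<Rightarrow> ('p \<Rightarrow> real) \<Rightarrow> real ^ 'p::{finite,order} \<Rightarrow> 'p \<Rightarrow> real" where
  "psi_at M t y p =
     (if p \<in> M then y $ p
      else y $ p + t p * Max ((\<lambda>q. psi_at M t y q) ` {q. q \<prec>c p}))"
  by pat_completeness auto

termination
proof (relation "Wellfounded.measure (\<lambda>(M, t, y, p). card {z. z < p})", goal_cases)
  case 1
  show ?case by simp
next
  case (2 M t y p q)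
  then have "q < p" by (simp add: covered_by_def)
  then have "{z. z < q} \<subset> {z. z < p}" by (auto dest: less_trans)
  then show ?case by (simp add: psubset_card_mono)
qed

declare psi_at.simps [simp del]

definition psi ::
  "'p set \<Rightarrow> ('p \<Rightarrow> real) \<Rightarrow> real ^ 'p::{finite,order} \<Rightarrow> real ^ 'p::{finite,order}" where
  "psi M t y = (\<chi> p. psi_at M t y p)"

text \<open>
  Since the pieces are closed and finite in number, a map that is piecewise linear in this sense
  is continuous on its domain.
\<close>

definition piecewise_linear_on ::
  "'a::euclidean_space set \<Rightarrow> ('a \<Rightarrow> 'b::euclidean_space) \<Rightarrow> bool" where
  "piecewise_linear_on S f \<longleftrightarrow>
     (\<exists>C. finite C \<and> \<Union>C = S \<and>
        (\<forall>K\<in>C. polyhedron K \<and> (\<exists>A b. linear A \<and> (\<forall>x\<in>K. f x = A x + b))))"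

lemma ex_marked_chain_ending_at:
  fixes p :: "'p::{finite,order}"
  assumes "minimal_elements_marked M"
  shows "\<exists>ps. ps \<noteq> [] \<and> hd ps \<in> M \<and> set (tl ps) \<subseteq> - M \<and> successively (\<prec>c) ps \<and> last ps = p"
proof (induction "card {z. z < p}" arbitrary: p rule: less_induct)
  case less
  show ?case
  proof (cases "p \<in> M")
    case True
    then show ?thesis by (intro exI[of _ "[p]"]) simp
  next
    case False
    then have "{q. q < p} \<noteq> {}"
      using assms by (auto simp: minimal_elements_marked_def)
    then obtain q where q: "q < p" "\<And>z. z < p \<Longrightarrow> q \<le> z \<Longrightarrow> q = z"
      using finite_has_maximal[of "{q. q < p}"] by auto
    then have qp: "q \<prec>c p" unfolding covered_by_def using less_imp_le less_irrefl by metis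
    have "{z. z < q} \<subset> {z. z < p}" using q(1) by (auto dest: less_trans)
    then have "card {z. z < q} < card {z. z < p}" by (simp add: psubset_card_mono)
    from less[OF this] obtain ps where
      ps: "ps \<noteq> []" "hd ps \<in> M" "set (tl ps) \<subseteq> - M" "successively (\<prec>c) ps" "last ps = q"
      by blast
    then show ?thesis using qp False
      by (intro exI[of _ "ps @ [p]"]) (auto simp: successively_append_iff)
  qed
qed

lemma marked_order_polyhedron_eq:
  assumes "minimal_elements_marked M"
  shows "marked_order_polyhedron M lam = poset_polyhedron M lam (\<lambda>_. 0)"
proof -
  have sum0: "(\<Sum>i<length ps. (\<Prod>j\<in>{i<..<length ps}. (0::real)) * x $ (ps ! i)) = x $ last ps"
    if "ps \<noteq> []" for ps :: "'a list" and x
  proof -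
    have "(\<Sum>i<length ps. (\<Prod>j\<in>{i<..<length ps}. (0::real)) * x $ (ps ! i))
        = (\<Sum>i<length ps. if i = length ps - 1 then x $ (ps ! i) else 0)"
    proof (intro sum.cong refl)
      fix i assume i: "i \<in> {..<length ps}"
      show "(\<Prod>j\<in>{i<..<length ps}. (0::real)) * x $ (ps ! i)
          = (if i = length ps - 1 then x $ (ps ! i) else 0)"
      proof (cases "i = length ps - 1")
        case True
        then have "{i<..<length ps} = {}" by auto
        then show ?thesis using True by simp
      next
        case False
        then have "length ps - 1 \<in> {i<..<length ps}" using i by auto
        then have "{i<..<length ps} \<noteq> {}" by blast
        then have "card {i<..<length ps} \<noteq> 0" by (simp only: card_eq_0_iff) simp
        then show ?thesis using False by (simp only: prod_constant power_0_left) simp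
      qed
    qed
    also have "\<dots> = x $ last ps" using that by (simp add: last_conv_nth)
    finally show ?thesis .
  qed
  show ?thesis
  proof (intro set_eqI iffI)
    fix x assume "x \<in> marked_order_polyhedron M lam"
    then show "x \<in> poset_polyhedron M lam (\<lambda>_. 0)"
      by (auto simp: marked_order_polyhedron_def poset_polyhedron_def marked_chain_to_def
          param_ext_def sum0 successively_append_iff simp del: prod_constant)
  next
    fix x assume x: "x \<in> poset_polyhedron M lam (\<lambda>_. 0)"
    have "x $ p \<le> x $ q" if pq: "p \<prec>c q" for p q
    proof -
      obtain ps where "ps \<noteq> []" "hd ps \<in> M" "set (tl ps) \<subseteq> - M" "successively (\<prec>c) ps" "last ps = p"
        using ex_marked_chain_ending_at[OF assms] by blast
      then have "marked_chain_to M ps q" "ps \<noteq> []" "last ps = p"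
        using pq by (auto simp: marked_chain_to_def successively_append_iff)
      moreover from this(1) have
        "(\<Sum>i<length ps. (\<Prod>j\<in>{i<..<length ps}. (0::real)) * x $ (ps ! i)) \<le> x $ q"
        using x by (auto simp: poset_polyhedron_def param_ext_def simp del: prod_constant)
      ultimately show ?thesis using sum0[of ps x] by metis
    qed
    then show "x \<in> marked_order_polyhedron M lam"
      using x by (auto simp: marked_order_polyhedron_def poset_polyhedron_def)
  qed
qed

end

theory Submission
  imports Defs
begin

text \<open>
  For a saturated chain \<open>ps\<close> from a marked element up to \<open>q\<close>, let \<open>S(ps)\<close> be the weighted sum in the
  inequalities defining the polyhedron with parameter \<open>t\<close>. If \<open>y = \<phi>\<^sub>t(x)\<close>, the recursions
  \<open>S(ps @ [p]) = t\<^sub>p S(ps) + y\<^sub>p\<close> and \<open>x\<^sub>p = y\<^sub>p + t\<^sub>p max\<^sub>q x\<^sub>q\<close> show that \<open>x\<^sub>q\<close> is the largest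
  value of \<open>S\<close> on the chains ending at \<open>q\<close>; here \<open>t \<ge> 0\<close> enters.
  Hence, for fixed \<open>p\<close>, the chain inequalities for \<open>y\<close> say exactly
  \<open>(1 - t\<^sub>p) max\<^sub>q x\<^sub>q \<le> y\<^sub>p = x\<^sub>p - t\<^sub>p max\<^sub>q x\<^sub>q\<close>, that is \<open>max\<^sub>q x\<^sub>q \<le> x\<^sub>p\<close>. The map \<open>\<phi>\<^sub>t\<close> is
  linear wherever a choice of maximising lower covers is fixed.
\<close>

lemma covered_by_induct [case_names lower_covers]:
  fixes p :: "'p::{finite,order}"
  assumes "\<And>p. (\<And>q. q \<prec>c p \<Longrightarrow> P q) \<Longrightarrow> P p"
  shows "P p"
proof (induction "card {..<p}" arbitrary: p rule: less_induct)
  case less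
  have "card {..<q} < card {..<p}" if "q \<prec>c p" for q
  proof (rule psubset_card_mono)
    show "{..<q} \<subset> {..<p}"
      using that by (auto simp: covered_by_def)
  qed simp
  then show ?case
    using less assms by blast
qed

lemma ex_lower_cover:
  fixes p q :: "'p::{finite,order}"
  assumes "q < p"
  shows "\<exists>r. r \<prec>c p"
proof -
  obtain r where "r < p" "\<forall>z. z < p \<longrightarrow> r \<le> z \<longrightarrow> r = z"
    using finite_has_maximal[of "{..<p}"] assms by auto
  then have "r \<prec>c p"
    by (auto simp: covered_by_def)
  then show ?thesis ..
qed

lemma minimal_elements_marked_ex_lower_cover:
  assumes "minimal_elements_marked M" "p \<notin> M"
  shows "\<exists>q. q \<prec>c p"
  using assms ex_lower_cover unfolding minimal_elements_marked_def by blast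

definition cover_max :: "('p::order \<Rightarrow> 'a::linorder) \<Rightarrow> 'p \<Rightarrow> 'a" where
  "cover_max f p = Max (f ` {q. q \<prec>c p})"

lemma cover_max_cong: "(\<And>q. q \<prec>c p \<Longrightarrow> f q = g q) \<Longrightarrow> cover_max f p = cover_max g p"
  unfolding cover_max_def by (rule arg_cong[where f = Max]) (auto intro: image_cong)

lemma le_cover_max:
  fixes p q :: "'p::{finite,order}"
  assumes "q \<prec>c p"
  shows "f q \<le> cover_max f p"
  using assms unfolding cover_max_def by (intro Max_ge) auto

lemma cover_max_attained:
  fixes p :: "'p::{finite,order}"
  assumes "\<exists>q. q \<prec>c p"
  obtains q where "q \<prec>c p" "f q = cover_max f p"
proof -
  have "cover_max f p \<in> f ` {q. q \<prec>c p}"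
    using assms unfolding cover_max_def by (intro Max_in) auto
  then show ?thesis
    using that by auto
qed

lemma cover_max_eqI:
  fixes p m :: "'p::{finite,order}"
  assumes "m \<prec>c p" "\<And>q. q \<prec>c p \<Longrightarrow> f q \<le> f m"
  shows "cover_max f p = f m"
  using assms unfolding cover_max_def by (intro Max_eqI) auto

lemma cover_max_le_iff:
  fixes p :: "'p::{finite,order}"
  assumes "\<exists>q. q \<prec>c p"
  shows "cover_max f p \<le> d \<longleftrightarrow> (\<forall>q. q \<prec>c p \<longrightarrow> f q \<le> d)"
  using assms unfolding cover_max_def by (subst Max_le_iff) auto

lemma mult_cover_max:
  fixes f :: "'p::{finite,order} \<Rightarrow> 'a::linordered_semiring"
  assumes "\<exists>q. q \<prec>c p" "0 \<le> c"
  shows "c * cover_max f p = cover_max (\<lambda>q. c * f q) p"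
proof -
  obtain m where m: "m \<prec>c p" "f m = cover_max f p"
    using cover_max_attained[OF assms(1)] .
  have "c * f q \<le> c * f m" if "q \<prec>c p" for q
    using le_cover_max[OF that, of f] assms(2) unfolding m(2) by (rule mult_left_mono)
  then have "cover_max (\<lambda>q. c * f q) p = c * f m"
    by (rule cover_max_eqI[OF m(1)])
  then show ?thesis
    unfolding m(2) by (rule sym)
qed

lemma phi_marked [simp]: "p \<in> M \<Longrightarrow> phi M t x $ p = x $ p"
  by (simp add: phi_def)

lemma phi_unmarked: "p \<notin> M \<Longrightarrow> phi M t x $ p = x $ p - t p * cover_max (($) x) p"
  by (simp add: phi_def cover_max_def)

lemma psi_marked: "p \<in> M \<Longrightarrow> psi M t y $ p = y $ p"
  by (simp add: psi_def psi_at.simps)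

lemma psi_unmarked:
  "p \<notin> M \<Longrightarrow> psi M t y $ p = y $ p + t p * cover_max (($) (psi M t y)) p"
  by (simp add: psi_def psi_at.simps[of M t y p] cover_max_def)

lemma psi_phi: "psi M t (phi M t x) = x"
proof -
  have "psi M t (phi M t x) $ p = x $ p" for p
  proof (induction p rule: covered_by_induct)
    case (lower_covers p)
    then have "cover_max (($) (psi M t (phi M t x))) p = cover_max (($) x) p"
      by (rule cover_max_cong)
    then show ?case
      by (cases "p \<in> M") (simp_all add: psi_marked psi_unmarked phi_unmarked)
  qed
  then show ?thesis
    by (simp add: vec_eq_iff)
qed

lemma phi_psi: "phi M t (psi M t y) = y"
proof -
  have "phi M t (psi M t y) $ p = y $ p" for p
    by (cases "p \<in> M") (simp_all add: psi_marked psi_unmarked phi_unmarked)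
  then show ?thesis
    by (simp add: vec_eq_iff)
qed

inductive marked_chain :: "'p::order set \<Rightarrow> 'p list \<Rightarrow> 'p \<Rightarrow> bool" for M where
  singleton: "p \<in> M \<Longrightarrow> marked_chain M [p] p"
| snoc: "marked_chain M ps q \<Longrightarrow> q \<prec>c p \<Longrightarrow> p \<notin> M \<Longrightarrow> marked_chain M (ps @ [p]) p"

lemma marked_chain_iff:
  "marked_chain M ps p \<longleftrightarrow>
     ps \<noteq> [] \<and> hd ps \<in> M \<and> set (tl ps) \<subseteq> - M \<and> successively (\<prec>c) ps \<and> last ps = p"
  (is "_ \<longleftrightarrow> ?chain ps p")
proof
  assume "marked_chain M ps p"
  then show "?chain ps p"
    by induction (auto simp: successively_append_iff)
next
  assume "?chain ps p"
  then show "marked_chain M ps p"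
  proof (induction ps arbitrary: p rule: rev_induct)
    case (snoc r ps)
    then show ?case
      by (cases "ps = []")
        (auto simp: successively_append_iff intro: marked_chain.intros)
  qed simp
qed

lemma marked_chain_to_iff:
  "marked_chain_to M ps p \<longleftrightarrow> (\<exists>q. marked_chain M ps q \<and> q \<prec>c p)"
  by (auto simp: marked_chain_to_def marked_chain_iff successively_append_iff)

definition chain_sum :: "('p \<Rightarrow> real) \<Rightarrow> real ^ 'p::finite \<Rightarrow> 'p list \<Rightarrow> real" where
  "chain_sum t y ps = (\<Sum>i<length ps. (\<Prod>j\<in>{i<..<length ps}. t (ps ! j)) * y $ (ps ! i))"

lemma chain_sum_singleton [simp]: "chain_sum t y [p] = y $ p"
  by (simp add: chain_sum_def)

lemma chain_sum_snoc: "chain_sum t y (ps @ [p]) = t p * chain_sum t y ps + y $ p"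
proof -
  have "(\<Prod>j\<in>{i<..<Suc (length ps)}. t ((ps @ [p]) ! j)) =
      t p * (\<Prod>j\<in>{i<..<length ps}. t (ps ! j))" if "i < length ps" for i
  proof -
    have "{i<..<Suc (length ps)} = insert (length ps) {i<..<length ps}"
      using that by auto
    moreover have "(\<Prod>j\<in>{i<..<length ps}. t ((ps @ [p]) ! j)) =
        (\<Prod>j\<in>{i<..<length ps}. t (ps ! j))"
      by (rule prod.cong) (auto simp: nth_append)
    ultimately show ?thesis
      by simp
  qed
  moreover have "{length ps<..<Suc (length ps)} = {}"
    by auto
  ultimately show ?thesis
    by (simp add: chain_sum_def sum_distrib_left nth_append mult.assoc)
qed

lemma chain_sum_phi_le:
  fixes x :: "real ^ 'p::{finite,order}"
  assumes "marked_chain M ps p" and "\<And>p. p \<notin> M \<Longrightarrow> 0 \<le> t p"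
  shows "chain_sum t (phi M t x) ps \<le> x $ p"
  using assms(1)
proof induction
  case (singleton p)
  then show ?case by simp
next
  case (snoc ps q p)
  have "chain_sum t (phi M t x) ps \<le> cover_max (($) x) p"
    using snoc.IH le_cover_max[OF \<open>q \<prec>c p\<close>] by (rule order_trans)
  then have "t p * chain_sum t (phi M t x) ps \<le> t p * cover_max (($) x) p"
    using assms(2)[OF \<open>p \<notin> M\<close>] by (rule mult_left_mono)
  then show ?case
    using \<open>p \<notin> M\<close> by (simp add: chain_sum_snoc phi_unmarked)
qed

lemma chain_sum_phi_attained:
  fixes x :: "real ^ 'p::{finite,order}"
  assumes "minimal_elements_marked M"
  shows "\<exists>ps. marked_chain M ps p \<and> chain_sum t (phi M t x) ps = x $ p"
proof (induction p rule: covered_by_induct)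
  case (lower_covers p)
  show ?case
  proof (cases "p \<in> M")
    case True
    then show ?thesis
      using marked_chain.singleton by fastforce
  next
    case False
    then obtain q where q: "q \<prec>c p" "x $ q = cover_max (($) x) p"
      using cover_max_attained[OF minimal_elements_marked_ex_lower_cover[OF assms]] by metis
    then obtain ps where ps: "marked_chain M ps q" "chain_sum t (phi M t x) ps = x $ q"
      using lower_covers by blast
    have "chain_sum t (phi M t x) (ps @ [p]) = x $ p"
      using ps q False by (simp add: chain_sum_snoc phi_unmarked)
    then show ?thesis
      using marked_chain.snoc[OF ps(1) q(1) False] by blast
  qed
qed

lemma mult_chain_sums_phi_le_iff:
  fixes x :: "real ^ 'p::{finite,order}"
  assumes "minimal_elements_marked M" "\<And>p. p \<notin> M \<Longrightarrow> 0 \<le> t p" "0 \<le> c"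
  shows "(\<forall>ps. marked_chain M ps p \<longrightarrow> c * chain_sum t (phi M t x) ps \<le> d) \<longleftrightarrow> c * x $ p \<le> d"
proof
  assume "\<forall>ps. marked_chain M ps p \<longrightarrow> c * chain_sum t (phi M t x) ps \<le> d"
  then show "c * x $ p \<le> d"
    using chain_sum_phi_attained[OF assms(1)] by metis
next
  assume "c * x $ p \<le> d"
  moreover have "c * chain_sum t (phi M t x) ps \<le> c * x $ p" if "marked_chain M ps p" for ps
    using chain_sum_phi_le[OF that] assms(2,3) by (simp add: mult_left_mono)
  ultimately show "\<forall>ps. marked_chain M ps p \<longrightarrow> c * chain_sum t (phi M t x) ps \<le> d"
    by (blast intro: order_trans)
qed

lemma param_ext_marked [simp]: "p \<in> M \<Longrightarrow> param_ext M t p = 0"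
  and param_ext_unmarked [simp]: "p \<notin> M \<Longrightarrow> param_ext M t p = t p"
  by (simp_all add: param_ext_def)

lemma poset_polyhedron_iff:
  "y \<in> poset_polyhedron M lam t \<longleftrightarrow>
     (\<forall>a\<in>M. y $ a = lam a) \<and>
     (\<forall>p q. q \<prec>c p \<longrightarrow>
        (\<forall>ps. marked_chain M ps q \<longrightarrow> (1 - param_ext M t p) * chain_sum t y ps \<le> y $ p))"
  by (auto simp: poset_polyhedron_def chain_sum_def marked_chain_to_iff)

lemma lower_cover_inequalities_phi_iff:
  fixes x :: "real ^ 'p::{finite,order}"
  assumes "minimal_elements_marked M" "p \<notin> M \<Longrightarrow> t p \<le> 1"
  shows "(\<forall>q. q \<prec>c p \<longrightarrow> (1 - param_ext M t p) * x $ q \<le> phi M t x $ p) \<longleftrightarrow>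
    (\<forall>q. q \<prec>c p \<longrightarrow> x $ q \<le> x $ p)"
proof (cases "p \<in> M")
  case True
  then show ?thesis by simp
next
  case False
  let ?m = "cover_max (($) x) p"
  have has_lower_cover: "\<exists>q. q \<prec>c p"
    using minimal_elements_marked_ex_lower_cover[OF assms(1) False] .
  have "(\<forall>q. q \<prec>c p \<longrightarrow> (1 - t p) * x $ q \<le> phi M t x $ p) \<longleftrightarrow>
      (1 - t p) * ?m \<le> x $ p - t p * ?m"
    using assms(2) False
    by (simp add: phi_unmarked mult_cover_max[OF has_lower_cover] cover_max_le_iff[OF has_lower_cover])
  also have "\<dots> \<longleftrightarrow> ?m \<le> x $ p"
    by (simp add: algebra_simps)
  also have "\<dots> \<longleftrightarrow> (\<forall>q. q \<prec>c p \<longrightarrow> x $ q \<le> x $ p)"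
    using has_lower_cover by (rule cover_max_le_iff)
  finally show ?thesis
    using False by simp
qed

lemma phi_in_poset_polyhedron_iff:
  fixes x :: "real ^ 'p::{finite,order}"
  assumes "minimal_elements_marked M"
    and t: "\<And>p. p \<notin> M \<Longrightarrow> 0 \<le> t p \<and> t p \<le> 1"
  shows "phi M t x \<in> poset_polyhedron M lam t \<longleftrightarrow> x \<in> marked_order_polyhedron M lam"
proof -
  have "0 \<le> 1 - param_ext M t p" for p
    using t by (cases "p \<in> M") simp_all
  then have "phi M t x \<in> poset_polyhedron M lam t \<longleftrightarrow>
      (\<forall>a\<in>M. x $ a = lam a) \<and>
      (\<forall>p q. q \<prec>c p \<longrightarrow> (1 - param_ext M t p) * x $ q \<le> phi M t x $ p)"
    using t by (simp add: poset_polyhedron_iff mult_chain_sums_phi_le_iff[OF assms(1)])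
  also have "\<dots> \<longleftrightarrow> x \<in> marked_order_polyhedron M lam"
    using t by (auto simp: lower_cover_inequalities_phi_iff[OF assms(1)] marked_order_polyhedron_def)
  finally show ?thesis .
qed

lemma bij_betw_phi:
  fixes M :: "'p::{finite,order} set"
  assumes "minimal_elements_marked M" "\<And>p. p \<notin> M \<Longrightarrow> 0 \<le> t p \<and> t p \<le> 1"
  shows "bij_betw (phi M t) (marked_order_polyhedron M lam) (poset_polyhedron M lam t)"
proof (rule bij_betw_byWitness[where f' = "psi M t"])
  note iff = phi_in_poset_polyhedron_iff[OF assms]
  show "phi M t ` marked_order_polyhedron M lam \<subseteq> poset_polyhedron M lam t"
    by (auto simp: iff)
  show "psi M t ` poset_polyhedron M lam t \<subseteq> marked_order_polyhedron M lam"
    by (auto simp: phi_psi simp flip: iff)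
qed (simp_all add: psi_phi phi_psi)

lemma polyhedron_Collect_conj:
  "polyhedron {x. P x} \<Longrightarrow> polyhedron {x. Q x} \<Longrightarrow> polyhedron {x. P x \<and> Q x}"
  unfolding Collect_conj_eq by (rule polyhedron_Int)

lemma polyhedron_Collect_imp: "(P \<Longrightarrow> polyhedron {x. Q x}) \<Longrightarrow> polyhedron {x. P \<longrightarrow> Q x}"
  by (cases P) simp_all

lemma polyhedron_Collect_all:
  fixes P :: "'i::finite \<Rightarrow> 'a::euclidean_space \<Rightarrow> bool"
  assumes "\<And>i. polyhedron {x. P i x}"
  shows "polyhedron {x. \<forall>i. P i x}"
  unfolding Collect_all_eq using assms by (intro polyhedron_Inter) auto

lemma polyhedron_linear_le:
  fixes f :: "'a::euclidean_space \<Rightarrow> real"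
  assumes "linear f"
  shows "polyhedron {x. f x \<le> c}"
  using polyhedron_halfspace_le[of "adjoint f 1" c] by (simp add: adjoint_clauses[OF assms])

lemma polyhedron_linear_eq:
  fixes f :: "'a::euclidean_space \<Rightarrow> real"
  assumes "linear f"
  shows "polyhedron {x. f x = c}"
  using polyhedron_hyperplane[of "adjoint f 1" c] by (simp add: adjoint_clauses[OF assms])

lemma linear_vec_nth: "linear (\<lambda>x :: real ^ 'n::finite. x $ i)"
  by (rule bounded_linear.linear) (rule bounded_linear_vec_nth)

lemma polyhedron_component_eq: "polyhedron {x :: real ^ 'n::finite. x $ i = c}"
  by (rule polyhedron_linear_eq) (rule linear_vec_nth)

lemma polyhedron_component_le: "polyhedron {x :: real ^ 'n::finite. x $ i \<le> x $ j}"
  using polyhedron_linear_le[OF linear_compose_sub[OF linear_vec_nth[of i] linear_vec_nth[of j]], of 0]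
  by simp

lemma polyhedron_marked_order_polyhedron: "polyhedron (marked_order_polyhedron M lam)"
  unfolding marked_order_polyhedron_def Ball_def
  by (intro polyhedron_Collect_conj polyhedron_Collect_all polyhedron_Collect_imp
      polyhedron_component_eq polyhedron_component_le)

lemma piecewise_linear_on_subset:
  assumes "piecewise_linear_on S f" "polyhedron T" "T \<subseteq> S"
  shows "piecewise_linear_on T f"
proof -
  obtain C where C: "finite C" "\<Union>C = S"
    "\<And>K. K \<in> C \<Longrightarrow> polyhedron K \<and> (\<exists>A b. linear A \<and> (\<forall>x\<in>K. f x = A x + b))"
    using assms(1) unfolding piecewise_linear_on_def by blast
  have "polyhedron (T \<inter> K) \<and> (\<exists>A b. linear A \<and> (\<forall>x\<in>T \<inter> K. f x = A x + b))" if "K \<in> C" for K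
    using C(3)[OF that] assms(2) by blast
  moreover have "\<Union>((\<inter>) T ` C) = T"
    using C(2) assms(3) by auto
  ultimately show ?thesis
    unfolding piecewise_linear_on_def using C(1) by (intro exI[of _ "(\<inter>) T ` C"]) auto
qed

definition lower_cover_selections :: "'p::order set \<Rightarrow> ('p \<Rightarrow> 'p) set" where
  "lower_cover_selections M = {s. \<forall>p. p \<notin> M \<longrightarrow> s p \<prec>c p}"

definition selection_region :: "'p set \<Rightarrow> ('p \<Rightarrow> 'p) \<Rightarrow> (real ^ 'p::{finite,order}) set" where
  "selection_region M s = {x. \<forall>p. p \<notin> M \<longrightarrow> (\<forall>q. q \<prec>c p \<longrightarrow> x $ q \<le> x $ s p)}"

definition selection_map ::
  "'p set \<Rightarrow> ('p \<Rightarrow> real) \<Rightarrow> ('p \<Rightarrow> 'p) \<Rightarrow> real ^ 'p::finite \<Rightarrow> real ^ 'p" where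
  "selection_map M t s x = (\<chi> p. if p \<in> M then x $ p else x $ p - t p * x $ s p)"

lemma polyhedron_selection_region: "polyhedron (selection_region M s)"
  unfolding selection_region_def
  by (intro polyhedron_Collect_all polyhedron_Collect_imp polyhedron_component_le)

lemma linear_selection_map: "linear (selection_map M t s)"
  by (rule linearI) (simp_all add: selection_map_def vec_eq_iff algebra_simps)

lemma phi_eq_selection_map:
  assumes "s \<in> lower_cover_selections M" "x \<in> selection_region M s"
  shows "phi M t x = selection_map M t s x"
proof -
  have "cover_max (($) x) p = x $ s p" if "p \<notin> M" for p
    using assms that
    by (intro cover_max_eqI) (auto simp: lower_cover_selections_def selection_region_def)
  then show ?thesis
    by (simp add: vec_eq_iff selection_map_def phi_unmarked)
qed

lemma UN_selection_region:
  fixes M :: "'p::{finite,order} set"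
  assumes "minimal_elements_marked M"
  shows "(\<Union>s\<in>lower_cover_selections M. selection_region M s) = UNIV"
proof -
  have "x \<in> (\<Union>s\<in>lower_cover_selections M. selection_region M s)" for x
  proof -
    have "\<exists>m. p \<notin> M \<longrightarrow> m \<prec>c p \<and> x $ m = cover_max (($) x) p" for p
      using cover_max_attained[OF minimal_elements_marked_ex_lower_cover[OF assms]] by metis
    then obtain s where "\<And>p. p \<notin> M \<Longrightarrow> s p \<prec>c p \<and> x $ s p = cover_max (($) x) p"
      by metis
    then have "s \<in> lower_cover_selections M" "x \<in> selection_region M s"
      by (auto simp: lower_cover_selections_def selection_region_def le_cover_max)
    then show ?thesis
      by blast
  qed
  then show ?thesis
    by blast
qed

lemma piecewise_linear_phi:
  fixes M :: "'p::{finite,order} set"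
  assumes "minimal_elements_marked M"
  shows "piecewise_linear_on UNIV (phi M t)"
  unfolding piecewise_linear_on_def
proof (intro exI[of _ "selection_region M ` lower_cover_selections M"] conjI ballI)
  show "\<Union>(selection_region M ` lower_cover_selections M) = UNIV"
    using assms by (rule UN_selection_region)
next
  fix K assume "K \<in> selection_region M ` lower_cover_selections M"
  then obtain s where s: "s \<in> lower_cover_selections M" and K: "K = selection_region M s"
    by blast
  show "polyhedron K"
    unfolding K by (rule polyhedron_selection_region)
  show "\<exists>A b. linear A \<and> (\<forall>x\<in>K. phi M t x = A x + b)"
    using linear_selection_map phi_eq_selection_map[OF s] unfolding K
    by (intro exI[of _ "selection_map M t s"] exI[of _ 0]) simp
qed simp

theorem theorem2p1:
  fixes M :: "'p::{finite,order} set" and lam t :: "'p \<Rightarrow> real"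
  assumes "marked_poset M lam"
    and "minimal_elements_marked M"
    and "\<And>p. p \<notin> M \<Longrightarrow> 0 \<le> t p \<and> t p \<le> 1"
  shows "(\<forall>x. psi M t (phi M t x) = x) \<and>
         (\<forall>y. phi M t (psi M t y) = y) \<and>
         bij_betw (phi M t) (marked_order_polyhedron M lam) (poset_polyhedron M lam t) \<and>
         piecewise_linear_on (marked_order_polyhedron M lam) (phi M t)"
proof (intro conjI allI)
  show "psi M t (phi M t x) = x" for x
    by (rule psi_phi)
  show "phi M t (psi M t y) = y" for y
    by (rule phi_psi)
  show "bij_betw (phi M t) (marked_order_polyhedron M lam) (poset_polyhedron M lam t)"
    using assms(2,3) by (rule bij_betw_phi)
  show "piecewise_linear_on (marked_order_polyhedron M lam) (phi M t)"
    using piecewise_linear_phi[OF assms(2)] polyhedron_marked_order_polyhedron subset_UNIV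
    by (rule piecewise_linear_on_subset)
qed

end
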